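(* Let $p,q\ge 0$ and $k\ge 0$ be integers, and let $A$ be a tensor field of type $(p,q)$ and class $C^{k}$ along the curve $x(s)$, with components $A^{j_1\cdots j_p}_{i_1\cdots i_q}(s)$ in the local coordinates. Then the $k$-th covariant derivative $\nabla^k A$ of $A$ along the curve is given by $$\nabla^{k} A^{j_{1}\cdots j_{p}}_{i_{1}\cdots i_{q}} = \sum_{a=0}^{k}\ \sum_{m_{1}+\cdots+m_{p}+l_{1}+\cdots+l_{q}=a} P_{u_{1}}^{j_{1}\langle m_{1}\rangle}\cdots P_{u_{p}}^{j_{p}\langle m_{p}\rangle}\, Q_{i_{1}}^{v_{1}\langle l_{1}\rangle}\cdots Q_{i_{q}}^{v_{q}\langle l_{q}\rangle}\, \frac{d^{k-a}A^{u_{1}\cdots u_{p}}_{v_{1}\cdots v_{q}}}{ds^{k-a}}\, \frac{k!}{(k-a)!\,m_{1}!\cdots m_{p}!\,l_{1}!\cdots l_{q}!},$$ where $m_1,\dots,m_p,l_1,\dots,l_q$ range over $\{0,1,2,\dots\}$ and the repeated indices $u_1,\dots,u_p,v_1,\dots,v_q$ are summed over $\{1,\dots,n\}$.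
   Context: Let $M_n$ be an $n$-dimensional differentiable manifold with an affine connection whose Christoffel symbols in a local coordinate system $(x^1,\dots,x^n)$ are $\Gamma^i_{jl}$, and let $x(s)$ be a given curve lying in the coordinate domain. The manifold, connection and curve are smooth. All indices run over $\{1,\dots,n\}$ and repeated upper/lower indices are summed (Einstein convention). Functions on the curve are regarded as functions of $s$. The symbols $P^{i\langle k\rangle}_j$ and $Q^{i\langle k\rangle}_j$ (functions of $s$; $\langle k\rangle$ is a label, not an exponent) are defined recursively for $k\in\{0,1,2,\dots\}$ by $$P^{i\langle 0\rangle}_j=\delta^i_j,\qquad P^{i\langle 1\rangle}_j=\Gamma^i_{jl}\frac{dx^l}{ds},\qquad P^{i\langle k+1\rangle}_j=\frac{dP^{i\langle k\rangle}_j}{ds}+P^{l\langle k\rangle}_jP^{i\langle 1\rangle}_l,$$ $$Q^{i\langle 0\rangle}_j=\delta^i_j,\qquad Q^{i\langle 1\rangle}_j=-\Gamma^i_{jl}\frac{dx^l}{ds},\qquad Q^{i\langle k+1\rangle}_j=\frac{dQ^{i\langle k\rangle}_j}{ds}+Q^{i\langle k\rangle}_lQ^{l\langle 1\rangle}_j.$$ The covariant derivative along the curve is $$\nabla A^{j_1\cdots j_p}_{i_1\cdots i_q}=\frac{d}{ds}A^{j_1\cdots j_p}_{i_1\cdots i_q}+\sum_{r=1}^{p}\Gamma^{j_r}_{ul}\frac{dx^l}{ds}A^{j_1\cdots u\cdots j_p}_{i_1\cdots i_q}-\sum_{r=1}^{q}\Gamma^{v}_{i_rl}\frac{dx^l}{ds}A^{j_1\cdots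 j_p}_{i_1\cdots v\cdots i_q},$$ where $u$ (resp. $v$) occupies the $r$-th upper (resp. lower) position. $\nabla^0$ is the identity and $\nabla^{k}$ is the $k$-fold iterate of $\nabla$. The notation $\nabla^k A^{j_1\cdots j_p}_{i_1\cdots i_q}$ means the components of $\nabla^kA$. *)

theory Defs
  imports "HOL-Analysis.Analysis"
begin

text \<open>
  Derivatives of functions on an interval \<open>I\<close> are taken within \<open>I\<close>, so they are one-sided at
  end points that belong to \<open>I\<close>. At interior points this is the ordinary derivative.
\<close>

definition ddt :: "real set \<Rightarrow> (real \<Rightarrow> real) \<Rightarrow> real \<Rightarrow> real" where
  "ddt I f s = vector_derivative f (at s within I)"

definition class_C :: "nat \<Rightarrow> real set \<Rightarrow> (real \<Rightarrow> real) \<Rightarrow> bool" where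
  "class_C k I f \<longleftrightarrow>
     (\<forall>j<k. \<forall>s\<in>I. ((ddt I ^^ j) f) differentiable (at s within I)) \<and>
     continuous_on I ((ddt I ^^ k) f)"

definition partial :: "'n::finite \<Rightarrow> (real^'n \<Rightarrow> real) \<Rightarrow> real^'n \<Rightarrow> real" where
  "partial i f y = frechet_derivative f (at y) (axis i 1)"

text \<open>\<open>class_C_multi k U f\<close> is meant for open \<open>U\<close> only.\<close>

primrec class_C_multi :: "nat \<Rightarrow> (real^'n::finite) set \<Rightarrow> (real^'n \<Rightarrow> real) \<Rightarrow> bool" where
  "class_C_multi 0 U f \<longleftrightarrow> continuous_on U f"
| "class_C_multi (Suc k) U f \<longleftrightarrow>
     (\<forall>y\<in>U. f differentiable (at y)) \<and> (\<forall>i. class_C_multi k U (partial i f))"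

definition smooth_multi :: "(real^'n::finite) set \<Rightarrow> (real^'n \<Rightarrow> real) \<Rightarrow> bool" where
  "smooth_multi U f \<longleftrightarrow> (\<forall>k. class_C_multi k U f)"


text \<open>The dimension \<open>n\<close> is \<open>CARD('n)\<close>, and \<open>'n\<close> is the index set of coordinates.\<close>

datatype ('a, 'n::finite) chart =
  Chart (chart_dom: "'a set") (coords: "'a \<Rightarrow> real^'n")

text \<open>
  \<open>transition c d\<close> expresses the coordinates of the chart \<open>d\<close> through those of \<open>c\<close>;
  it is meaningful on the coordinate image \<open>overlap c d\<close> of the common domain.
\<close>

definition transition :: "('a, 'n::finite) chart \<Rightarrow> ('a, 'n) chart \<Rightarrow> 'n \<Rightarrow> real^'n \<Rightarrow> real" where
  "transition c d i y = coords d (inv_into (chart_dom c) (coords c) y) $ i"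

definition overlap :: "('a, 'n::finite) chart \<Rightarrow> ('a, 'n) chart \<Rightarrow> (real^'n) set" where
  "overlap c d = coords c ` (chart_dom c \<inter> chart_dom d)"

locale smooth_manifold =
  fixes M :: "'a topology" and atlas :: "('a, 'n::finite) chart set"
  assumes Hausdorff: "Hausdorff_space M"
    and second_countable: "second_countable M"
    and covering: "(\<Union>c\<in>atlas. chart_dom c) = topspace M"
    and dom_open: "c \<in> atlas \<Longrightarrow> openin M (chart_dom c)"
    and image_open: "c \<in> atlas \<Longrightarrow> open (coords c ` chart_dom c)"
    and chart_homeo: "c \<in> atlas \<Longrightarrow>
      homeomorphic_map (subtopology M (chart_dom c))
        (top_of_set (coords c ` chart_dom c)) (coords c)"
    and compatible: "c \<in> atlas \<Longrightarrow> d \<in> atlas \<Longrightarrow>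
      smooth_multi (overlap c d) (transition c d i)"

text \<open>
  \<open>\<Gamma> c i j l\<close> is the Christoffel symbol with upper index \<open>i\<close> and lower indices \<open>j, l\<close> in the
  chart \<open>c\<close>, as a function of the coordinates. An affine connection is a family of such symbols
  obeying the classical transformation law; no symmetry in \<open>j, l\<close> is assumed.
\<close>

type_synonym ('a, 'n) christoffel =
  "('a, 'n) chart \<Rightarrow> 'n \<Rightarrow> 'n \<Rightarrow> 'n \<Rightarrow> real^'n \<Rightarrow> real"

locale affine_connection = smooth_manifold M atlas
  for M :: "'a topology" and atlas :: "('a, 'n::finite) chart set" +
  fixes \<Gamma> :: "('a, 'n) christoffel"
  assumes smooth: "c \<in> atlas \<Longrightarrow> smooth_multi (coords c ` chart_dom c) (\<Gamma> c i j l)"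
    and transformation: "c \<in> atlas \<Longrightarrow> d \<in> atlas \<Longrightarrow> m \<in> chart_dom c \<inter> chart_dom d \<Longrightarrow>
      \<Gamma> d i j l (coords d m) =
        (\<Sum>a\<in>UNIV. partial a (transition c d i) (coords c m) *
          ((\<Sum>b\<in>UNIV. \<Sum>e\<in>UNIV.
              partial j (transition d c b) (coords d m) *
              partial l (transition d c e) (coords d m) * \<Gamma> c a b e (coords c m)) +
           partial j (partial l (transition d c a)) (coords d m)))"


definition smooth_curve ::
    "'a topology \<Rightarrow> ('a, 'n::finite) chart set \<Rightarrow> real set \<Rightarrow> (real \<Rightarrow> 'a) \<Rightarrow> bool" where
  "smooth_curve M atlas I x \<longleftrightarrow>
     continuous_map (top_of_set I) M x \<and>
     (\<forall>c\<in>atlas. \<forall>l k. class_C k {s\<in>I. x s \<in> chart_dom c} (\<lambda>s. coords c (x s) $ l))"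

text \<open>
  A tensor field along a curve is given by its components in each chart: \<open>A c js ks s\<close> is the
  component with upper indices \<open>js\<close> and lower indices \<open>ks\<close> at the parameter \<open>s\<close>.
\<close>

type_synonym ('a, 'n) tensor_along =
  "('a, 'n) chart \<Rightarrow> 'n list \<Rightarrow> 'n list \<Rightarrow> real \<Rightarrow> real"

definition tensor_field_along ::
    "('a, 'n::finite) chart set \<Rightarrow> real set \<Rightarrow> (real \<Rightarrow> 'a) \<Rightarrow> nat \<Rightarrow> nat \<Rightarrow>
     ('a, 'n) tensor_along \<Rightarrow> bool" where
  "tensor_field_along atlas I x p q A \<longleftrightarrow>
     (\<forall>c\<in>atlas. \<forall>d\<in>atlas. \<forall>s\<in>I. x s \<in> chart_dom c \<inter> chart_dom d \<longrightarrow>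
       (\<forall>js ks. length js = p \<longrightarrow> length ks = q \<longrightarrow>
         A d js ks s =
           (\<Sum>us\<in>{us. length us = p}. \<Sum>vs\<in>{vs. length vs = q}.
             (\<Prod>r<p. partial (us ! r) (transition c d (js ! r)) (coords c (x s))) *
             (\<Prod>r<q. partial (ks ! r) (transition d c (vs ! r)) (coords d (x s))) *
             A c us vs s)))"

definition tensor_class_C ::
    "nat \<Rightarrow> ('a, 'n::finite) chart set \<Rightarrow> real set \<Rightarrow> (real \<Rightarrow> 'a) \<Rightarrow> nat \<Rightarrow> nat \<Rightarrow>
     ('a, 'n) tensor_along \<Rightarrow> bool" where
  "tensor_class_C k atlas I x p q A \<longleftrightarrow>
     (\<forall>c\<in>atlas. \<forall>js ks. length js = p \<longrightarrow> length ks = q \<longrightarrow>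
       class_C k {s\<in>I. x s \<in> chart_dom c} (A c js ks))"


text \<open>\<open>\<Gamma>\<^sup>i\<^sub>j\<^sub>l dx\<^sup>l/ds\<close> along the curve, in the chart \<open>c\<close>:\<close>

definition conn_coeff ::
    "('a, 'n::finite) christoffel \<Rightarrow> real set \<Rightarrow> (real \<Rightarrow> 'a) \<Rightarrow> ('a, 'n) chart \<Rightarrow>
     'n \<Rightarrow> 'n \<Rightarrow> real \<Rightarrow> real" where
  "conn_coeff \<Gamma> I x c i j s =
     (\<Sum>l\<in>UNIV. \<Gamma> c i j l (coords c (x s)) * ddt I (\<lambda>t. coords c (x t) $ l) s)"

text \<open>In \<open>P_sym \<Gamma> I x c k i j\<close> and \<open>Q_sym \<Gamma> I x c k i j\<close>, \<open>i\<close> is the upper and \<open>j\<close> the lower index.\<close>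

fun P_sym ::
    "('a, 'n::finite) christoffel \<Rightarrow> real set \<Rightarrow> (real \<Rightarrow> 'a) \<Rightarrow> ('a, 'n) chart \<Rightarrow>
     nat \<Rightarrow> 'n \<Rightarrow> 'n \<Rightarrow> real \<Rightarrow> real" where
  "P_sym \<Gamma> I x c 0 i j s = (if i = j then 1 else 0)"
| "P_sym \<Gamma> I x c (Suc 0) i j s = conn_coeff \<Gamma> I x c i j s"
| "P_sym \<Gamma> I x c (Suc (Suc k)) i j s =
     ddt I (P_sym \<Gamma> I x c (Suc k) i j) s +
     (\<Sum>l\<in>UNIV. P_sym \<Gamma> I x c (Suc k) l j s * P_sym \<Gamma> I x c (Suc 0) i l s)"

fun Q_sym ::
    "('a, 'n::finite) christoffel \<Rightarrow> real set \<Rightarrow> (real \<Rightarrow> 'a) \<Rightarrow> ('a, 'n) chart \<Rightarrow>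
     nat \<Rightarrow> 'n \<Rightarrow> 'n \<Rightarrow> real \<Rightarrow> real" where
  "Q_sym \<Gamma> I x c 0 i j s = (if i = j then 1 else 0)"
| "Q_sym \<Gamma> I x c (Suc 0) i j s = - conn_coeff \<Gamma> I x c i j s"
| "Q_sym \<Gamma> I x c (Suc (Suc k)) i j s =
     ddt I (Q_sym \<Gamma> I x c (Suc k) i j) s +
     (\<Sum>l\<in>UNIV. Q_sym \<Gamma> I x c (Suc k) i l s * Q_sym \<Gamma> I x c (Suc 0) l j s)"

definition cov_deriv ::
    "('a, 'n::finite) christoffel \<Rightarrow> real set \<Rightarrow> (real \<Rightarrow> 'a) \<Rightarrow>
     ('a, 'n) tensor_along \<Rightarrow> ('a, 'n) tensor_along" where
  "cov_deriv \<Gamma> I x A = (\<lambda>c js ks s.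
     ddt I (A c js ks) s
     + (\<Sum>r<length js. \<Sum>u\<in>UNIV. conn_coeff \<Gamma> I x c (js ! r) u s * A c (js[r := u]) ks s)
     - (\<Sum>r<length ks. \<Sum>v\<in>UNIV. conn_coeff \<Gamma> I x c v (ks ! r) s * A c js (ks[r := v]) s))"

end

theory Submission
  imports Defs
begin

text \<open>Upper indices are transported by \<open>P\<close> and lower ones by the transpose of \<open>Q\<close>, and both families
  satisfy \<open>R\<^bsup>m+1\<^esup> = dR\<^bsup>m\<^esup>/ds + R\<^bsup>1\<^esup> R\<^bsup>m\<^esup>\<close>, so all \<open>p + q\<close> indices can be treated as slots of one
  multi-index. By the product rule and this recursion, \<open>\<nabla>\<close> maps the term with orders \<open>(j, m\<^sub>1, \<dots>, m\<^sub>N)\<close> to the sum of the terms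
  in which one of these \<open>N + 1\<close> orders is raised by one, exactly as in the multinomial theorem for a
  sum of \<open>N + 1\<close> commuting operators. The order \<open>j\<close> of differentiation of the components is kept as
  entry \<open>0\<close> of the list of orders.\<close>

section \<open>Functions of class C^k on a perfect set\<close>

lemma ddt_works:
  assumes "f differentiable (at s within I)"
  shows "(f has_real_derivative ddt I f s) (at s within I)"
  using assms
  by (simp add: ddt_def has_real_derivative_iff_has_vector_derivative vector_derivative_works)

lemma differentiable_within_cong:
  assumes "\<And>t. t \<in> I \<Longrightarrow> f t = g t" "s \<in> I" "f differentiable (at s within I)"
  shows "g differentiable (at s within I)"
  using assms has_derivative_transform[of s I g f] unfolding differentiable_def by metis

lemma has_vector_derivative_within_cong:
  assumes "\<And>t. t \<in> I \<Longrightarrow> f t = g t" "s \<in> I"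
  shows "(f has_vector_derivative D) (at s within I) \<longleftrightarrow> (g has_vector_derivative D) (at s within I)"
  using assms has_vector_derivative_transform[of s I g f D] has_vector_derivative_transform[of s I f g D]
  by auto

lemma ddt_cong:
  assumes "\<And>t. t \<in> I \<Longrightarrow> f t = g t" "s \<in> I"
  shows "ddt I f s = ddt I g s"
  using has_vector_derivative_within_cong[OF assms] by (simp add: ddt_def vector_derivative_def)

lemma class_C_0: "class_C 0 I f \<longleftrightarrow> continuous_on I f"
  by (simp add: class_C_def)

text \<open>The definition peels off derivatives at the outer end; moving the first one inside by
  \<open>funpow_Suc_right\<close> lets inductions on \<open>k\<close> pass from \<open>f\<close> to
  \<open>ddt I f\<close>.\<close>

lemma class_C_Suc:
  "class_C (Suc k) I f \<longleftrightarrow>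
     (\<forall>s\<in>I. f differentiable (at s within I)) \<and> class_C k I (ddt I f)"
  unfolding class_C_def All_less_Suc2 funpow_Suc_right o_apply funpow_0 by blast

lemma class_C_cong:
  assumes "\<And>t. t \<in> I \<Longrightarrow> f t = g t"
  shows "class_C k I f \<longleftrightarrow> class_C k I g"
  using assms
proof (induction k arbitrary: f g)
  case 0
  then show ?case by (simp add: class_C_0 cong: continuous_on_cong)
next
  case (Suc k)
  have "class_C k I (ddt I f) \<longleftrightarrow> class_C k I (ddt I g)"
    using Suc.prems by (intro Suc.IH ddt_cong) auto
  moreover have "f differentiable (at s within I) \<longleftrightarrow> g differentiable (at s within I)"
    if "s \<in> I" for s
    using differentiable_within_cong[of I f g s] differentiable_within_cong[of I g f s] Suc.prems that
    by auto
  ultimately show ?case by (auto simp: class_C_Suc)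
qed

lemma class_C_SucD: "class_C (Suc k) I f \<Longrightarrow> class_C k I f"
proof (induction k arbitrary: f)
  case 0
  then show ?case
    by (auto simp: class_C_Suc class_C_0 continuous_on_eq_continuous_within
        intro: differentiable_imp_continuous_within)
next
  case (Suc k)
  then show ?case by (metis class_C_Suc)
qed

lemma class_C_Suc_has_derivative:
  "class_C (Suc k) I f \<Longrightarrow> s \<in> I \<Longrightarrow> (f has_real_derivative ddt I f s) (at s within I)"
  by (simp add: class_C_Suc ddt_works)

lemma class_C_imp_differentiable:
  assumes "class_C k I f" "j < k" "s \<in> I"
  shows "(ddt I ^^ j) f differentiable (at s within I)"
  using assms by (simp add: class_C_def)

text \<open>Every point of \<open>I\<close> is a limit point of \<open>I\<close>, so derivatives
  within \<open>I\<close> are unique and \<open>ddt\<close>, defined through a choice operator,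
  equals any derivative that has been exhibited.\<close>

locale perfect_domain =
  fixes I :: "real set"
  assumes not_bot: "s \<in> I \<Longrightarrow> at s within I \<noteq> bot"
begin

lemma ddt_eqI:
  assumes "(f has_real_derivative D) (at s within I)" "s \<in> I"
  shows "ddt I f s = D"
  using assms not_bot
  by (simp add: ddt_def has_real_derivative_iff_has_vector_derivative vector_derivative_within)

lemma class_C_SucI:
  assumes "\<And>s. s \<in> I \<Longrightarrow> (f has_real_derivative f' s) (at s within I)" "class_C k I f'"
  shows "class_C (Suc k) I f"
proof -
  have "class_C k I (ddt I f)"
    using assms(2) class_C_cong[of I "ddt I f" f' k] ddt_eqI[OF assms(1)] by simp
  moreover have "f differentiable (at s within I)" if "s \<in> I" for s
    using assms(1)[OF that] real_differentiable_def by blast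
  ultimately show ?thesis by (simp add: class_C_Suc)
qed

lemma ddt_const: "s \<in> I \<Longrightarrow> ddt I (\<lambda>_. a) s = 0"
  by (rule ddt_eqI) auto

lemma class_C_const: "class_C k I (\<lambda>_. a)"
proof (induction k arbitrary: a)
  case (Suc k)
  show ?case by (rule class_C_SucI[OF DERIV_const Suc.IH])
qed (simp add: class_C_0)

lemma class_C_add:
  assumes "class_C k I f" "class_C k I g"
  shows "class_C k I (\<lambda>t. f t + g t)"
  using assms
proof (induction k arbitrary: f g)
  case 0
  then show ?case by (simp add: class_C_0 continuous_on_add)
next
  case (Suc k)
  note d = Suc.prems[THEN class_C_Suc_has_derivative] and c = Suc.prems[unfolded class_C_Suc]
  show ?case
    using class_C_SucI[where f' = "\<lambda>s. ddt I f s + ddt I g s"] DERIV_add[OF d] Suc.IH c by simp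
qed

lemma class_C_sum:
  assumes "\<And>i. i \<in> S \<Longrightarrow> class_C k I (f i)"
  shows "class_C k I (\<lambda>t. \<Sum>i\<in>S. f i t)"
  using assms by (induction S rule: infinite_finite_induct) (auto intro: class_C_const class_C_add)

text \<open>In the product rule each factor also occurs undifferentiated;
  \<open>class_C_SucD\<close> brings it down to class \<open>k\<close>, so that the induction
  hypothesis applies to both products.\<close>

lemma class_C_mult:
  assumes "class_C k I f" "class_C k I g"
  shows "class_C k I (\<lambda>t. f t * g t)"
  using assms
proof (induction k arbitrary: f g)
  case 0
  then show ?case by (simp add: class_C_0 continuous_on_mult)
next
  case (Suc k)
  note d = Suc.prems[THEN class_C_Suc_has_derivative] and c = Suc.prems[unfolded class_C_Suc]
    and l = Suc.prems[THEN class_C_SucD]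
  show ?case
    using class_C_SucI[where f' = "\<lambda>s. f s * ddt I g s + ddt I f s * g s"]
      DERIV_mult'[OF d] class_C_add Suc.IH c l by simp
qed

lemma class_C_minus: "class_C k I f \<Longrightarrow> class_C k I (\<lambda>t. - f t)"
  using class_C_mult[OF class_C_const[of k "-1"], of f] by simp

end

section \<open>Composition of functions of several variables with a curve\<close>

lemma chain_rule_partial:
  fixes y :: "real \<Rightarrow> real^'n::finite"
  assumes f: "f differentiable (at (y s))"
    and y: "\<And>i. ((\<lambda>t. y t $ i) has_real_derivative D i) (at s within I)"
  shows "((\<lambda>t. f (y t)) has_real_derivative (\<Sum>i\<in>UNIV. partial i f (y s) * D i)) (at s within I)"
proof -
  let ?F = "frechet_derivative f (at (y s))"
  have "(y has_derivative (\<lambda>h. \<chi> i. D i * h)) (at s within I)"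
    using y by (subst has_derivative_componentwise_within)
      (auto simp: Basis_vec_def cart_eq_inner_axis[symmetric] has_field_derivative_def)
  moreover have F: "(f has_derivative ?F) (at (y s))"
    using f by (simp add: frechet_derivative_works)
  ultimately have "((\<lambda>t. f (y t)) has_derivative (\<lambda>h. ?F (\<chi> i. D i * h))) (at s within I)"
    using has_derivative_compose by blast
  \<comment> \<open>Expanding the tangent vector in the standard basis turns the linear map
    \<open>?F\<close> into a combination of partial derivatives.\<close>
  moreover have "?F (\<chi> i. D i * h) = (\<Sum>i\<in>UNIV. partial i f (y s) * D i) * h" for h
  proof -
    have lin: "linear ?F"
      using F has_derivative_linear by blast
    have "(\<chi> i. D i * h) = (\<Sum>i\<in>UNIV. (D i * h) *\<^sub>R axis i 1)"
      using basis_expansion[of "\<chi> i. D i * h"] by (simp add: scalar_mult_eq_scaleR)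
    then show ?thesis
      using lin by (simp add: linear_sum linear_cmul partial_def sum_distrib_right mult_ac)
  qed
  ultimately show ?thesis
    by (simp add: has_field_derivative_def)
qed

context perfect_domain
begin

text \<open>The chain rule gives a sum of products of \<open>partial i f\<close> along
  \<open>y\<close> with derivatives of the coordinates. The first factor has class \<open>k\<close>
  by the induction hypothesis for \<open>partial i f\<close>, which is why \<open>f\<close> is
  generalised.\<close>

lemma class_C_compose:
  fixes y :: "real \<Rightarrow> real^'n::finite"
  assumes "class_C_multi k U f" and "\<And>i. class_C k I (\<lambda>t. y t $ i)" and "y ` I \<subseteq> U"
  shows "class_C k I (\<lambda>t. f (y t))"
  using assms
proof (induction k arbitrary: f)
  case 0
  have "continuous_on I (\<lambda>t. \<chi> i. y t $ i)"
    using 0(2) by (intro continuous_on_vec_lambda) (simp add: class_C_0)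
  with 0 show ?case
    by (simp add: class_C_0 continuous_on_compose2)
next
  case (Suc k)
  have y: "class_C k I (\<lambda>t. y t $ i)" "class_C k I (ddt I (\<lambda>t. y t $ i))"
    and dy: "s \<in> I \<Longrightarrow> ((\<lambda>t. y t $ i) has_real_derivative ddt I (\<lambda>t. y t $ i) s) (at s within I)"
    for s i
    using Suc.prems(2)[THEN class_C_SucD] Suc.prems(2)[unfolded class_C_Suc]
      Suc.prems(2)[THEN class_C_Suc_has_derivative] by simp_all
  show ?case
  proof (rule class_C_SucI)
    fix s assume "s \<in> I"
    then show "((\<lambda>t. f (y t)) has_real_derivative
        (\<Sum>i\<in>UNIV. partial i f (y s) * ddt I (\<lambda>t. y t $ i) s)) (at s within I)"
      using Suc.prems(1,3) by (intro chain_rule_partial dy) auto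
  next
    show "class_C k I (\<lambda>s. \<Sum>i\<in>UNIV. partial i f (y s) * ddt I (\<lambda>t. y t $ i) s)"
    proof (intro class_C_sum class_C_mult y)
      fix i
      show "class_C k I (\<lambda>t. partial i f (y t))"
        using Suc.prems(1,3) by (intro Suc.IH[of "partial i f"] y) simp_all
    qed
  qed
qed

end

section \<open>The multinomial recursion\<close>

lemma finite_lists_sum_eq: "finite {ns :: nat list. length ns = N \<and> sum_list ns = k}"
  by (rule finite_subset[OF _ finite_lists_length_eq[of "{..k}" N]])
    (auto dest: member_le_sum_list)

text \<open>This is the Pascal rule for multinomial coefficients, summed against \<open>G\<close>: a
  list \<open>ns\<close> of total \<open>Suc k\<close> arises by raising an entry \<open>r\<close>
  of a list of total \<open>k\<close>, and entry \<open>r\<close> contributes the fraction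
  \<open>ns ! r / Suc k\<close> of its coefficient.\<close>

lemma multinomial_step:
  fixes G :: "nat list \<Rightarrow> real"
  shows "(\<Sum>ns | length ns = N \<and> sum_list ns = k.
      fact k / (\<Prod>r<N. fact (ns ! r)) * (\<Sum>r<N. G (ns[r := Suc (ns ! r)]))) =
    (\<Sum>ns | length ns = N \<and> sum_list ns = Suc k. fact (Suc k) / (\<Prod>r<N. fact (ns ! r)) * G ns)"
    (is "?L = ?R")
proof -
  define S :: "nat \<Rightarrow> nat list set" where "S k = {ns. length ns = N \<and> sum_list ns = k}" for k
  \<comment> \<open>The numerator stays \<open>fact k\<close> even on lists of total
    \<open>Suc k\<close>; the missing factor \<open>Suc k\<close> appears at the end as the sum of
    the entries.\<close>
  define c :: "nat list \<Rightarrow> real" where "c ns = fact k / (\<Prod>r<N. fact (ns ! r))" for ns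
  have fin: "finite (S j)" for j
    unfolding S_def by (rule finite_lists_sum_eq)
  have step: "(\<Sum>ns\<in>S k. c ns * G (ns[r := Suc (ns ! r)])) = (\<Sum>ns\<in>S (Suc k). real (ns ! r) * c ns * G ns)"
    if r: "r < N" for r
  proof -
    have c_upd: "real (Suc (ns ! r)) * c (ns[r := Suc (ns ! r)]) = c ns" if "length ns = N" for ns
    proof -
      have "(\<Prod>i<N. fact (ns[r := Suc (ns ! r)] ! i) :: real) = real (Suc (ns ! r)) * (\<Prod>i<N. fact (ns ! i))"
        using r that
        by (auto simp: prod.remove[of "{..<N}" r] mult.assoc nth_list_update
            intro!: arg_cong2[where f = "(*)"] prod.cong)
      then show ?thesis by (simp add: c_def del: of_nat_Suc)
    qed
    \<comment> \<open>Raising entry \<open>r\<close> is a bijection onto the lists whose entry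
      \<open>r\<close> is nonzero, so the truncated subtraction in the inverse is exact. The
      remaining lists can be added afterwards because their weight \<open>ns ! r\<close> is
      zero.\<close>
    have "(\<Sum>ns\<in>S k. c ns * G (ns[r := Suc (ns ! r)])) =
      (\<Sum>ns\<in>{ns \<in> S (Suc k). ns ! r \<noteq> 0}. real (ns ! r) * c ns * G ns)"
      by (rule sum.reindex_bij_witness[where j = "\<lambda>ns. ns[r := Suc (ns ! r)]" and i = "\<lambda>ns. ns[r := ns ! r - 1]"])
        (use r c_upd in \<open>auto simp: S_def sum_list_update\<close>)
    also have "\<dots> = (\<Sum>ns\<in>S (Suc k). real (ns ! r) * c ns * G ns)"
      by (rule sum.mono_neutral_left) (auto simp: fin)
    finally show ?thesis .
  qed
  have "?L = (\<Sum>r<N. \<Sum>ns\<in>S k. c ns * G (ns[r := Suc (ns ! r)]))"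
    unfolding c_def S_def sum_distrib_left by (rule sum.swap)
  also have "\<dots> = (\<Sum>r<N. \<Sum>ns\<in>S (Suc k). real (ns ! r) * c ns * G ns)"
    by (intro sum.cong refl step) simp
  also have "\<dots> = (\<Sum>ns\<in>S (Suc k). (\<Sum>r<N. real (ns ! r)) * c ns * G ns)"
    unfolding sum_distrib_right by (rule sum.swap)
  also have "\<dots> = ?R"
  proof -
    have "(\<Sum>r<N. real (ns ! r)) = real (Suc k)" if "ns \<in> S (Suc k)" for ns
      using that by (auto simp: S_def sum_list_sum_nth atLeast0LessThan simp flip: of_nat_sum)
    then show ?thesis
      unfolding S_def[symmetric] by (intro sum.cong refl) (simp add: c_def)
  qed
  finally show ?thesis .
qed

section \<open>Iterated derivatives of multi-indexed families\<close>

lemma finite_lists_length: "finite {us :: 'n::finite list. length us = N}"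
  using finite_lists_length_eq[of "UNIV :: 'n set" N] by simp

lemma has_real_derivative_prod:
  fixes f :: "'i \<Rightarrow> real \<Rightarrow> real"
  assumes "\<And>i. i \<in> S \<Longrightarrow> (f i has_real_derivative f' i) (at x within I)"
  shows "((\<lambda>x. \<Prod>i\<in>S. f i x) has_real_derivative (\<Sum>i\<in>S. f' i * (\<Prod>j\<in>S - {i}. f j x)))
    (at x within I)"
proof -
  have "((\<lambda>x. \<Prod>i\<in>S. f i x) has_derivative (\<lambda>y. \<Sum>i\<in>S. f' i * y * (\<Prod>j\<in>S - {i}. f j x)))
      (at x within I)"
    using assms by (intro has_derivative_prod) (simp add: has_field_derivative_def)
  then show ?thesis
    unfolding has_field_derivative_def
    by (rule has_derivative_eq_rhs) (simp add: fun_eq_iff sum_distrib_left mult_ac)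
qed

text \<open>\<open>R r m i j\<close> is the symbol of order \<open>m\<close> in slot
  \<open>r\<close>, with free index \<open>i\<close> and summed index \<open>j\<close>. Letting
  \<open>R\<close> depend on the slot covers upper and lower indices at once.\<close>

locale slot_system = perfect_domain I for I +
  fixes R :: "nat \<Rightarrow> nat \<Rightarrow> 'n::finite \<Rightarrow> 'n \<Rightarrow> real \<Rightarrow> real"
  assumes R_0: "R r 0 i j s = (if i = j then 1 else 0)"
    and R_Suc: "s \<in> I \<Longrightarrow> R r (Suc m) i j s =
      ddt I (R r m i j) s + (\<Sum>w\<in>UNIV. R r 1 i w s * R r m w j s)"
    and R_differentiable: "s \<in> I \<Longrightarrow> R r m i j differentiable (at s within I)"
begin

text \<open>All connection terms carry a plus sign: the minus sign of lower indices is to be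
  absorbed in \<open>R r 1\<close>.\<close>

definition slot_deriv :: "('n list \<Rightarrow> real \<Rightarrow> real) \<Rightarrow> 'n list \<Rightarrow> real \<Rightarrow> real" where
  "slot_deriv B js s =
    ddt I (B js) s + (\<Sum>r<length js. \<Sum>w\<in>UNIV. R r 1 (js ! r) w s * B (js[r := w]) s)"

text \<open>One summand of the expansion, stripped of its multinomial coefficient; the shift to
  \<open>Suc r\<close> makes room for the differentiation order in entry \<open>0\<close>.\<close>

definition slot_term ::
    "('n list \<Rightarrow> real \<Rightarrow> real) \<Rightarrow> nat list \<Rightarrow> 'n list \<Rightarrow> real \<Rightarrow> real" where
  "slot_term B ns js s = (\<Sum>us | length us = length js.
    (\<Prod>r<length js. R r (ns ! Suc r) (js ! r) (us ! r) s) * (ddt I ^^ (ns ! 0)) (B us) s)"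

text \<open>Only index lists of the same length and parameters in \<open>I\<close> enter
  \<open>slot_deriv\<close>, so an induction hypothesis valid just there may be substituted under
  it.\<close>

lemma slot_deriv_cong:
  assumes "\<And>js' t. length js' = length js \<Longrightarrow> t \<in> I \<Longrightarrow> B js' t = B' js' t" and "s \<in> I"
  shows "slot_deriv B js s = slot_deriv B' js s"
  using assms ddt_cong[of I "B js" "B' js" s] by (simp add: slot_deriv_def)

lemma slot_deriv_linear:
  assumes "s \<in> I" and "\<And>x. x \<in> S \<Longrightarrow> T x js differentiable (at s within I)"
  shows "slot_deriv (\<lambda>js s. \<Sum>x\<in>S. a x * T x js s) js s = (\<Sum>x\<in>S. a x * slot_deriv (T x) js s)"
proof -
  have "ddt I (\<lambda>s. \<Sum>x\<in>S. a x * T x js s) s = (\<Sum>x\<in>S. a x * ddt I (T x js) s)"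
    using assms by (intro ddt_eqI DERIV_sum DERIV_cmult ddt_works)
  moreover have "(\<Sum>r<length js. \<Sum>w\<in>UNIV. R r 1 (js ! r) w s * (\<Sum>x\<in>S. a x * T x (js[r := w]) s)) =
    (\<Sum>x\<in>S. a x * (\<Sum>r<length js. \<Sum>w\<in>UNIV. R r 1 (js ! r) w s * T x (js[r := w]) s))"
    by (simp add: sum_distrib_left sum.swap[where B = S] mult_ac)
  ultimately show ?thesis
    by (simp add: slot_deriv_def sum.distrib distrib_left)
qed

lemma slot_term_has_derivative:
  assumes "s \<in> I"
    and "\<And>us. length us = length js \<Longrightarrow> (ddt I ^^ (ns ! 0)) (B us) differentiable (at s within I)"
  shows "(slot_term B ns js has_real_derivative
    (\<Sum>us | length us = length js.
      (\<Prod>r<length js. R r (ns ! Suc r) (js ! r) (us ! r) s) * (ddt I ^^ Suc (ns ! 0)) (B us) s +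
      (\<Sum>r<length js. ddt I (R r (ns ! Suc r) (js ! r) (us ! r)) s *
        (\<Prod>i\<in>{..<length js} - {r}. R i (ns ! Suc i) (js ! i) (us ! i) s)) *
      (ddt I ^^ (ns ! 0)) (B us) s)) (at s within I)"
  unfolding slot_term_def[abs_def] funpow.simps o_apply
  by (intro DERIV_sum DERIV_mult' has_real_derivative_prod ddt_works R_differentiable assms) auto

text \<open>The product rule differentiates either the components, which raises entry
  \<open>0\<close>, or the factor of one slot \<open>r\<close>. By \<open>R_Suc\<close>, the latter
  together with the connection term of slot \<open>r\<close> is that factor with its order raised by
  one.\<close>

lemma slot_deriv_slot_term:
  assumes s: "s \<in> I" and len: "length ns = Suc (length js)"
    and B: "\<And>us. length us = length js \<Longrightarrow> (ddt I ^^ (ns ! 0)) (B us) differentiable (at s within I)"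
  shows "slot_deriv (slot_term B ns) js s =
    (\<Sum>r<Suc (length js). slot_term B (ns[r := Suc (ns ! r)]) js s)"
proof -
  define L where "L = length js"
  define U where "U = {us :: 'n list. length us = L}"
  define F where "F r us = R r (ns ! Suc r) (js ! r) (us ! r) s" for r us
  \<comment> \<open>The factors of the slots other than \<open>r\<close> are unaffected by changing
    the index or the order in slot \<open>r\<close>, which \<open>conn\<close> and
    \<open>raise\<close> exploit.\<close>
  define O' where "O' r us = (\<Prod>i\<in>{..<L} - {r}. F i us)" for r us
  define D where "D us = (ddt I ^^ (ns ! 0)) (B us) s" for us
  have conn: "slot_term B ns (js[r := w]) s =
      (\<Sum>us\<in>U. R r (ns ! Suc r) w (us ! r) s * O' r us * D us)" if "r < L" for r w
    unfolding slot_term_def O'_def F_def D_def U_def L_def using that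
    by (intro sum.cong) (auto simp: L_def prod.remove[of "{..<length js}" r] intro!: prod.cong)
  have raise: "slot_term B (ns[Suc r := Suc (ns ! Suc r)]) js s =
      (\<Sum>us\<in>U. R r (Suc (ns ! Suc r)) (js ! r) (us ! r) s * O' r us * D us)" if "r < L" for r
    unfolding slot_term_def O'_def F_def D_def U_def L_def using that len
    by (intro sum.cong) (auto simp: L_def prod.remove[of "{..<length js}" r] intro!: prod.cong)
  have ddt: "ddt I (slot_term B ns js) s =
      (\<Sum>us\<in>U. (\<Prod>r<L. F r us) * (ddt I ^^ Suc (ns ! 0)) (B us) s +
        (\<Sum>r<L. ddt I (R r (ns ! Suc r) (js ! r) (us ! r)) s * O' r us) * D us)"
    unfolding O'_def F_def D_def U_def L_def
    by (rule ddt_eqI[OF slot_term_has_derivative[OF s B] s])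
  also have "\<dots> = slot_term B (ns[0 := Suc (ns ! 0)]) js s +
      (\<Sum>r<L. \<Sum>us\<in>U. ddt I (R r (ns ! Suc r) (js ! r) (us ! r)) s * O' r us * D us)"
    using len unfolding slot_term_def F_def U_def L_def sum.distrib sum_distrib_right
    by (subst sum.swap) (cases ns, simp_all)
  finally have "slot_deriv (slot_term B ns) js s = slot_term B (ns[0 := Suc (ns ! 0)]) js s +
      (\<Sum>r<L. (\<Sum>us\<in>U. ddt I (R r (ns ! Suc r) (js ! r) (us ! r)) s * O' r us * D us) +
        (\<Sum>w\<in>UNIV. R r 1 (js ! r) w s * slot_term B ns (js[r := w]) s))"
    by (simp add: slot_deriv_def L_def sum.distrib)
  also have "(\<Sum>r<L. (\<Sum>us\<in>U. ddt I (R r (ns ! Suc r) (js ! r) (us ! r)) s * O' r us * D us) +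
        (\<Sum>w\<in>UNIV. R r 1 (js ! r) w s * slot_term B ns (js[r := w]) s)) =
      (\<Sum>r<L. slot_term B (ns[Suc r := Suc (ns ! Suc r)]) js s)"
  proof (rule sum.cong[OF refl])
    fix r assume "r \<in> {..<L}"
    then have r: "r < L" by simp
    \<comment> \<open>Exchanging the sums over \<open>w\<close> and \<open>us\<close> exposes the
      matrix product that occurs in \<open>R_Suc\<close>.\<close>
    have "(\<Sum>w\<in>UNIV. R r 1 (js ! r) w s * slot_term B ns (js[r := w]) s) =
      (\<Sum>us\<in>U. (\<Sum>w\<in>UNIV. R r 1 (js ! r) w s * R r (ns ! Suc r) w (us ! r) s) * O' r us * D us)"
      unfolding conn[OF r] sum_distrib_left sum_distrib_right
      by (subst sum.swap) (simp add: mult_ac)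
    then show "(\<Sum>us\<in>U. ddt I (R r (ns ! Suc r) (js ! r) (us ! r)) s * O' r us * D us) +
        (\<Sum>w\<in>UNIV. R r 1 (js ! r) w s * slot_term B ns (js[r := w]) s) =
      slot_term B (ns[Suc r := Suc (ns ! Suc r)]) js s"
      unfolding raise[OF r] R_Suc[OF s] by (simp add: sum.distrib distrib_right)
  qed
  finally show ?thesis
    unfolding sum.lessThan_Suc_shift L_def .
qed

text \<open>Linearity carries \<open>slot_deriv\<close> through the expansion of order
  \<open>k\<close>, \<open>slot_deriv_slot_term\<close> raises one order in each term, and
  \<open>multinomial_step\<close> collects the coefficients. Indices and parameter vary in the
  induction because \<open>slot_deriv\<close> replaces the former and differentiates in the
  latter.\<close>

lemma funpow_slot_deriv:
  assumes "\<And>us. length us = length js \<Longrightarrow> class_C k I (B us)" and "s \<in> I"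
  shows "(slot_deriv ^^ k) B js s =
    (\<Sum>ns | length ns = Suc (length js) \<and> sum_list ns = k.
      fact k / (\<Prod>r<Suc (length js). fact (ns ! r)) * slot_term B ns js s)"
  using assms
proof (induction k arbitrary: js s)
  case 0
  have "{ns. length ns = Suc (length js) \<and> sum_list ns = 0} = {replicate (Suc (length js)) (0::nat)}"
    by (auto simp: sum_list_replicate simp del: replicate.simps intro!: replicate_eqI)
  moreover have "slot_term B (replicate (Suc (length js)) 0) js s = B js s"
  proof -
    \<comment> \<open>Symbols of order zero are Kronecker deltas, so the sum over \<open>us\<close>
      collapses to \<open>us = js\<close>.\<close>
    have "(\<Prod>r<length js. R r 0 (js ! r) (us ! r) s) = (if us = js then 1 else 0)"
      if len: "length us = length js" for us
    proof (cases "us = js")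
      case False
      then obtain r where "r < length js" "js ! r \<noteq> us ! r"
        using len nth_equalityI by metis
      with False show ?thesis
        by (auto simp: R_0 intro!: prod_zero)
    qed (simp add: R_0)
    then have "slot_term B (replicate (Suc (length js)) 0) js s =
      (\<Sum>us | length us = length js. if us = js then B us s else 0)"
      unfolding slot_term_def by (intro sum.cong) auto
    then show ?thesis
      by (simp add: finite_lists_length)
  qed
  ultimately show ?case
    by (simp del: replicate.simps prod.lessThan_Suc)
next
  case (Suc k)
  define N where "N = length js"
  define S where "S = {ns. length ns = Suc N \<and> sum_list ns = k}"
  define c :: "nat list \<Rightarrow> real" where "c ns = fact k / (\<Prod>r<Suc N. fact (ns ! r))" for ns
  have IH: "(slot_deriv ^^ k) B js' t = (\<Sum>ns\<in>S. c ns * slot_term B ns js' t)"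
    if "length js' = length js" "t \<in> I" for js' t
    using Suc.IH[of js' t] Suc.prems(1)[THEN class_C_SucD] that by (simp add: S_def c_def N_def)
  \<comment> \<open>An entry of a list of total \<open>k\<close> is at most \<open>k\<close>, so
    class \<open>Suc k\<close> leaves one further derivative.\<close>
  have diff: "(ddt I ^^ (ns ! 0)) (B us) differentiable (at s within I)"
    if "ns \<in> S" "length us = length js" for ns us
  proof (rule class_C_imp_differentiable[OF Suc.prems(1)])
    show "ns ! 0 < Suc k"
      using that member_le_sum_list[of "ns ! 0" ns] nth_mem[of 0 ns] by (auto simp: S_def)
  qed (use that Suc.prems in auto)
  have "(slot_deriv ^^ Suc k) B js s = slot_deriv (\<lambda>js s. \<Sum>ns\<in>S. c ns * slot_term B ns js s) js s"
    using slot_deriv_cong[OF IH Suc.prems(2)] by simp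
  also have "\<dots> = (\<Sum>ns\<in>S. c ns * slot_deriv (slot_term B ns) js s)"
  proof (rule slot_deriv_linear[OF Suc.prems(2)])
    fix ns assume "ns \<in> S"
    then show "slot_term B ns js differentiable (at s within I)"
      using slot_term_has_derivative[OF Suc.prems(2), of js ns B] diff real_differentiable_def by blast
  qed
  also have "\<dots> = (\<Sum>ns\<in>S. c ns * (\<Sum>r<Suc N. slot_term B (ns[r := Suc (ns ! r)]) js s))"
    unfolding N_def using diff Suc.prems(2)
    by (intro sum.cong refl arg_cong2[where f = "(*)"] slot_deriv_slot_term) (auto simp: S_def N_def)
  finally show ?case
    using multinomial_step[of k "Suc N" "\<lambda>ns. slot_term B ns js s"]
    by (simp only: S_def c_def N_def)
qed

end

section \<open>Covariant derivatives along a curve\<close>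

text \<open>A connected set that is not a singleton has no isolated points, and a nonempty interior
  excludes singletons.\<close>

lemma perfect_domain_interval:
  assumes "is_interval I" "interior I \<noteq> {}"
  shows "perfect_domain I"
proof
  fix s :: real assume "s \<in> I"
  moreover have "I \<noteq> {a}" for a
    using assms(2) by auto
  ultimately show "at s within I \<noteq> bot"
    using assms(1) connected_imp_perfect[of I s]
    by (auto simp: is_interval_connected trivial_limit_within)
qed

section \<open>Splitting sums and products over concatenated lists\<close>

lemma sum_lessThan_add: "(\<Sum>r<p + q. f r) = (\<Sum>r<p. f r) + (\<Sum>r<q. f (p + r))"
  for f :: "nat \<Rightarrow> 'a::comm_monoid_add"
  by (induction q) (simp_all add: add_ac)

lemma prod_lessThan_add: "(\<Prod>r<p + q. f r) = (\<Prod>r<p. f r) * (\<Prod>r<q. f (p + r))"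
  for f :: "nat \<Rightarrow> 'a::comm_monoid_mult"
  by (induction q) (simp_all add: mult_ac)

lemma sum_lists_append:
  fixes f :: "'n::finite list \<Rightarrow> real"
  shows "(\<Sum>us | length us = p + q. f us) =
    (\<Sum>us | length us = p. \<Sum>vs | length vs = q. f (us @ vs))"
  unfolding sum.cartesian_product
  by (rule sum.reindex_bij_witness[where i = "\<lambda>(us, vs). us @ vs" and j = "\<lambda>us. (take p us, drop p us)"])
    auto

text \<open>The total \<open>a\<close> of the tail determines the head as \<open>k - a\<close>; the
  tail is then cut after \<open>p\<close> entries.\<close>

lemma sum_compositions_split:
  fixes f :: "nat list \<Rightarrow> real"
  shows "(\<Sum>ns | length ns = Suc (p + q) \<and> sum_list ns = k. f ns) =
    (\<Sum>a = 0..k. \<Sum>(ms, ls) | length ms = p \<and> length ls = q \<and> sum_list ms + sum_list ls = a.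
      f ((k - a) # ms @ ls))"
proof -
  have fin: "finite {(ms :: nat list, ls). length ms = p \<and> length ls = q \<and> sum_list ms + sum_list ls = a}" for a
  proof (rule finite_subset)
    show "{(ms :: nat list, ls). length ms = p \<and> length ls = q \<and> sum_list ms + sum_list ls = a} \<subseteq>
        (\<Union>b\<le>a. {ms. length ms = p \<and> sum_list ms = b}) \<times> (\<Union>b\<le>a. {ls. length ls = q \<and> sum_list ls = b})"
      by auto
  qed (intro finite_cartesian_product finite_UN_I finite_lists_sum_eq finite_atMost)
  define W where
    "W a = {(ms :: nat list, ls). length ms = p \<and> length ls = q \<and> sum_list ms + sum_list ls = a}" for a
  have "(\<Sum>ns | length ns = Suc (p + q) \<and> sum_list ns = k. f ns) =
    (\<Sum>(a, ms, ls)\<in>(SIGMA a:{0..k}. W a). f ((k - a) # ms @ ls))"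
  proof (rule sum.reindex_bij_witness[where i = "\<lambda>(a, ms, ls). (k - a) # ms @ ls"
      and j = "\<lambda>ns. (k - ns ! 0, take p (tl ns), drop p (tl ns))"])
    fix ns assume "ns \<in> {ns. length ns = Suc (p + q) \<and> sum_list ns = k}"
    then obtain n ns' where "ns = n # ns'" "length ns' = p + q" "n + sum_list ns' = k"
      by (cases ns) auto
    moreover have "sum_list (take p ns') + sum_list (drop p ns') = sum_list ns'"
      by (metis append_take_drop_id sum_list_append)
    ultimately show "(k - ns ! 0, take p (tl ns), drop p (tl ns)) \<in> (SIGMA a:{0..k}. W a)"
      and "(case (k - ns ! 0, take p (tl ns), drop p (tl ns)) of (a, ms, ls) \<Rightarrow> (k - a) # ms @ ls) = ns"
      and "(case (k - ns ! 0, take p (tl ns), drop p (tl ns)) of (a, ms, ls) \<Rightarrow> f ((k - a) # ms @ ls)) = f ns"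
      by (auto simp: W_def)
  qed (auto simp: W_def)
  also have "\<dots> = (\<Sum>a = 0..k. \<Sum>(ms, ls)\<in>W a. f ((k - a) # ms @ ls))"
    using fin by (simp add: sum.Sigma W_def)
  finally show ?thesis
    unfolding W_def .
qed

section \<open>Smoothness and recursion of the symbols P and Q along the curve\<close>

context perfect_domain
begin

lemma smooth_conn_coeff:
  assumes "affine_connection M atlas \<Gamma>" "smooth_curve M atlas I x" "c \<in> atlas"
    and "x ` I \<subseteq> chart_dom c"
  shows "class_C k I (conn_coeff \<Gamma> I x c i j)"
proof -
  interpret affine_connection M atlas \<Gamma> by fact
  have "{s \<in> I. x s \<in> chart_dom c} = I"
    using assms(4) by auto
  then have x: "class_C k I (\<lambda>t. coords c (x t) $ l)" for k l
    using assms(2,3) by (auto simp: smooth_curve_def)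
  have "class_C k I (\<lambda>s. \<Gamma> c i j l (coords c (x s)))" for l
  proof (rule class_C_compose[OF _ x])
    show "class_C_multi k (coords c ` chart_dom c) (\<Gamma> c i j l)"
      using smooth[OF assms(3)] by (simp add: smooth_multi_def)
  qed (use assms(4) in auto)
  \<comment> \<open>One order of smoothness of the coordinates is spent on \<open>ddt\<close>, hence
    \<open>x\<close> is used at \<open>Suc k\<close>.\<close>
  moreover have "class_C k I (ddt I (\<lambda>t. coords c (x t) $ l))" for l
    using x[of "Suc k" l] by (simp add: class_C_Suc)
  ultimately show ?thesis
    unfolding conn_coeff_def[abs_def] by (intro class_C_sum class_C_mult)
qed

text \<open>The defining recursion yields only orders from two on. Order zero is a constant
  Kronecker delta, whose derivative vanishes on \<open>I\<close>, so the step from order zero to one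
  has the same shape.\<close>

lemma P_sym_Suc:
  assumes "s \<in> I"
  shows "P_sym \<Gamma> I x c (Suc m) i j s = ddt I (P_sym \<Gamma> I x c m i j) s +
    (\<Sum>l\<in>UNIV. P_sym \<Gamma> I x c 1 i l s * P_sym \<Gamma> I x c m l j s)"
proof (cases m)
  case 0
  have "P_sym \<Gamma> I x c 0 i j = (\<lambda>s. if i = j then 1 else 0)" by auto
  with 0 assms show ?thesis by (simp add: ddt_const if_distrib[of "(*) _"] sum_negf cong: if_cong)
qed (simp add: mult.commute)

text \<open>For the transposed matrices the symbol of order one multiplies from the left, as the
  recursion of \<open>slot_system\<close> demands.\<close>

lemma Q_sym_Suc:
  assumes "s \<in> I"
  shows "Q_sym \<Gamma> I x c (Suc m) i j s = ddt I (Q_sym \<Gamma> I x c m i j) s +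
    (\<Sum>l\<in>UNIV. Q_sym \<Gamma> I x c 1 l j s * Q_sym \<Gamma> I x c m i l s)"
proof (cases m)
  case 0
  have "Q_sym \<Gamma> I x c 0 i j = (\<lambda>s. if i = j then 1 else 0)" by auto
  with 0 assms show ?thesis by (simp add: ddt_const if_distrib[of "(*) _"] sum_negf cong: if_cong)
qed (simp add: mult.commute)

text \<open>Each step of the recursion spends one derivative, so the induction on \<open>m\<close>
  keeps \<open>k\<close> arbitrary and uses the previous symbol at class
  \<open>Suc k\<close>.\<close>

lemma smooth_P_sym:
  assumes "\<And>k i j. class_C k I (conn_coeff \<Gamma> I x c i j)"
  shows "class_C k I (P_sym \<Gamma> I x c m i j)"
proof (induction m arbitrary: k i j)
  case 0
  have "P_sym \<Gamma> I x c 0 i j = (\<lambda>s. if i = j then 1 else 0)" by auto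
  then show ?case by (simp add: class_C_const)
next
  case (Suc m)
  have 1: "P_sym \<Gamma> I x c 1 i j = conn_coeff \<Gamma> I x c i j" for i j by auto
  have "class_C k I (ddt I (P_sym \<Gamma> I x c m i j))"
    using Suc[of "Suc k" i j] by (simp add: class_C_Suc)
  then have "class_C k I (\<lambda>s. ddt I (P_sym \<Gamma> I x c m i j) s +
      (\<Sum>l\<in>UNIV. P_sym \<Gamma> I x c 1 i l s * P_sym \<Gamma> I x c m l j s))"
    unfolding 1 by (intro class_C_add class_C_sum class_C_mult assms Suc)
  then show ?case
    by (subst class_C_cong[OF P_sym_Suc])
qed

lemma smooth_Q_sym:
  assumes "\<And>k i j. class_C k I (conn_coeff \<Gamma> I x c i j)"
  shows "class_C k I (Q_sym \<Gamma> I x c m i j)"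
proof (induction m arbitrary: k i j)
  case 0
  have "Q_sym \<Gamma> I x c 0 i j = (\<lambda>s. if i = j then 1 else 0)" by auto
  then show ?case by (simp add: class_C_const)
next
  case (Suc m)
  have 1: "Q_sym \<Gamma> I x c 1 i j = (\<lambda>s. - conn_coeff \<Gamma> I x c i j s)" for i j by auto
  have "class_C k I (ddt I (Q_sym \<Gamma> I x c m i j))"
    using Suc[of "Suc k" i j] by (simp add: class_C_Suc)
  then have "class_C k I (\<lambda>s. ddt I (Q_sym \<Gamma> I x c m i j) s +
      (\<Sum>l\<in>UNIV. Q_sym \<Gamma> I x c 1 l j s * Q_sym \<Gamma> I x c m i l s))"
    unfolding 1 by (intro class_C_add class_C_sum class_C_mult class_C_minus assms Suc)
  then show ?case
    by (subst class_C_cong[OF Q_sym_Suc])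
qed

end

text \<open>The free index of a tensor slot is the upper index of \<open>P\<close> but the lower
  index of \<open>Q\<close>, hence the swapped arguments in the second case.\<close>

definition slot_sym ::
    "('a, 'n::finite) christoffel \<Rightarrow> real set \<Rightarrow> (real \<Rightarrow> 'a) \<Rightarrow> ('a, 'n) chart \<Rightarrow> nat \<Rightarrow>
     nat \<Rightarrow> nat \<Rightarrow> 'n \<Rightarrow> 'n \<Rightarrow> real \<Rightarrow> real" where
  "slot_sym \<Gamma> I x c p r m i j = (if r < p then P_sym \<Gamma> I x c m i j else Q_sym \<Gamma> I x c m j i)"

lemma slot_system_slot_sym:
  assumes "perfect_domain I" and "\<And>k i j. class_C k I (conn_coeff \<Gamma> I x c i j)"
  shows "slot_system I (slot_sym \<Gamma> I x c p)"
proof -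
  interpret perfect_domain I by fact
  show ?thesis
  proof
    fix r m i j s assume "s \<in> I"
    then show "slot_sym \<Gamma> I x c p r m i j differentiable (at s within I)"
      using smooth_P_sym[OF assms(2), of "Suc 0" m i j] smooth_Q_sym[OF assms(2), of "Suc 0" m j i]
      by (simp add: slot_sym_def class_C_Suc)
  qed (simp_all add: slot_sym_def P_sym_Suc Q_sym_Suc)
qed

theorem theorem1:
  fixes M :: "'a topology" and atlas :: "('a, 'n::finite) chart set"
    and \<Gamma> :: "('a, 'n) christoffel"
    and I :: "real set" and x :: "real \<Rightarrow> 'a" and c :: "('a, 'n) chart"
    and p q k :: nat and A :: "('a, 'n) tensor_along"
  assumes "affine_connection M atlas \<Gamma>"
    and "is_interval I" and "interior I \<noteq> {}"
    and "smooth_curve M atlas I x"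
    and "c \<in> atlas" and "x ` I \<subseteq> chart_dom c"
    and "tensor_field_along atlas I x p q A" and "tensor_class_C k atlas I x p q A"
    and "s \<in> I" and "length js = p" and "length ks = q"
  shows "(cov_deriv \<Gamma> I x ^^ k) A c js ks s =
    (\<Sum>a=0..k.
      \<Sum>(ms, ls)\<in>{(ms, ls). length ms = p \<and> length ls = q \<and> sum_list ms + sum_list ls = a}.
        \<Sum>us\<in>{us. length us = p}. \<Sum>vs\<in>{vs. length vs = q}.
          (\<Prod>r<p. P_sym \<Gamma> I x c (ms ! r) (js ! r) (us ! r) s) *
          (\<Prod>r<q. Q_sym \<Gamma> I x c (ls ! r) (vs ! r) (ks ! r) s) *
          (ddt I ^^ (k - a)) (A c us vs) s *
          (fact k / (fact (k - a) * (\<Prod>r<p. fact (ms ! r)) * (\<Prod>r<q. fact (ls ! r)))))"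
proof -
  interpret perfect_domain I
    using assms(2,3) by (rule perfect_domain_interval)
  interpret slot_system I "slot_sym \<Gamma> I x c p"
    by (rule slot_system_slot_sym[OF perfect_domain_axioms smooth_conn_coeff[OF assms(1,4-6)]])
  \<comment> \<open>Upper indices come first and lower ones after them; cutting at \<open>p\<close>
    recovers both lists.\<close>
  define B where "B us = A c (take p us) (drop p us)" for us
  have I: "{s \<in> I. x s \<in> chart_dom c} = I"
    using assms(6) by auto
  have B: "class_C k I (B us)" if "length us = p + q" for us
    using assms(5,8) that by (auto simp: B_def tensor_class_C_def I)
  \<comment> \<open>Claimed for every real \<open>s\<close>, so that the two sides agree as
    functions and \<open>ddt\<close> can be rewritten by extensionality; the indices vary because
    connection terms replace them.\<close>
  have cov: "(cov_deriv \<Gamma> I x ^^ l) A c js ks s = (slot_deriv ^^ l) B (js @ ks) s"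
    if "length js = p" "length ks = q" for l js ks s
    using that
  proof (induction l arbitrary: js ks s)
    case 0
    then show ?case by (simp add: B_def)
  next
    case (Suc l)
    have ddt: "ddt I ((cov_deriv \<Gamma> I x ^^ l) A c js ks) s = ddt I ((slot_deriv ^^ l) B (js @ ks)) s"
      using Suc by (intro arg_cong2[where f = "ddt I"] ext refl) simp
    \<comment> \<open>Slots from \<open>p\<close> on contribute \<open>Q_sym\<close> of order one,
      the negated connection coefficient, which restores the minus sign of the lower index
      terms.\<close>
    have "(slot_deriv ^^ Suc l) B (js @ ks) s = ddt I ((slot_deriv ^^ l) B (js @ ks)) s +
      ((\<Sum>r<p. \<Sum>u\<in>UNIV. conn_coeff \<Gamma> I x c (js ! r) u s * (slot_deriv ^^ l) B (js[r := u] @ ks) s) +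
      (\<Sum>r<q. \<Sum>v\<in>UNIV. - conn_coeff \<Gamma> I x c v (ks ! r) s * (slot_deriv ^^ l) B (js @ ks[r := v]) s))"
      using Suc.prems
      by (simp add: slot_deriv_def[of "(slot_deriv ^^ l) B"] sum_lessThan_add slot_sym_def
          nth_append list_update_append)
    then show ?case
      using Suc ddt by (simp add: cov_deriv_def[of _ _ _ "(cov_deriv \<Gamma> I x ^^ l) A"] sum_negf)
  qed
  \<comment> \<open>The factorials split into those of the head, of \<open>ms\<close> and of
    \<open>ls\<close>, and the product over slots splits into its \<open>P\<close> and
    \<open>Q\<close> parts.\<close>
  have coefficient: "fact k / (\<Prod>r<Suc (p + q). fact (((k - a) # ms @ ls) ! r)) *
      slot_term B ((k - a) # ms @ ls) (js @ ks) s =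
    (\<Sum>us\<in>{us. length us = p}. \<Sum>vs\<in>{vs. length vs = q}.
      (\<Prod>r<p. P_sym \<Gamma> I x c (ms ! r) (js ! r) (us ! r) s) *
      (\<Prod>r<q. Q_sym \<Gamma> I x c (ls ! r) (vs ! r) (ks ! r) s) *
      (ddt I ^^ (k - a)) (A c us vs) s *
      (fact k / (fact (k - a) * (\<Prod>r<p. fact (ms ! r)) * (\<Prod>r<q. fact (ls ! r)))))"
    if len: "length ms = p" "length ls = q" for a ms ls
  proof -
    let ?ns = "(k - a) # ms @ ls"
    have "slot_term B ?ns (js @ ks) s = (\<Sum>us | length us = p. \<Sum>vs | length vs = q.
        (\<Prod>r<p. P_sym \<Gamma> I x c (ms ! r) (js ! r) (us ! r) s) *
        (\<Prod>r<q. Q_sym \<Gamma> I x c (ls ! r) (vs ! r) (ks ! r) s) * (ddt I ^^ (k - a)) (A c us vs) s)"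
      unfolding slot_term_def length_append assms(10,11) sum_lists_append prod_lessThan_add
      using len assms(10,11) by (intro sum.cong refl) (simp add: slot_sym_def nth_append B_def)
    moreover have "(\<Prod>r<Suc (p + q). fact (?ns ! r) :: real) =
        fact (k - a) * (\<Prod>r<p. fact (ms ! r)) * (\<Prod>r<q. fact (ls ! r))"
      using len unfolding prod.lessThan_Suc_shift prod_lessThan_add by (simp add: nth_append)
    ultimately show ?thesis
      by (simp only: sum_distrib_left mult_ac)
  qed
  have "(cov_deriv \<Gamma> I x ^^ k) A c js ks s =
    (\<Sum>a = 0..k. \<Sum>(ms, ls) | length ms = p \<and> length ls = q \<and> sum_list ms + sum_list ls = a.
      fact k / (\<Prod>r<Suc (p + q). fact (((k - a) # ms @ ls) ! r)) *
        slot_term B ((k - a) # ms @ ls) (js @ ks) s)"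
    using assms(9-11)
    by (subst cov, simp_all only: funpow_slot_deriv B sum_compositions_split length_append)
  then show ?thesis
    by (rule trans, intro sum.cong refl)
      (simp only: case_prod_unfold mem_Collect_eq coefficient)
qed

end
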